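(* Let $L>0$, $A_c>0$, $T_h>T_c>0$ and $\alpha_0\in\mathbb{R}$, $\alpha_0\neq0$. Let $\kappa\in C^1([T_c,\infty))$ with $\kappa>0$ on $[T_c,\infty)$, and let $\rho$ be locally Lipschitz continuous on $[T_c,\infty)$ with $\rho>0$ on $[T_c,\infty)$ and $\int_{T_c}^\infty\rho(T)\kappa(T)\,dT=\infty$. Then for any load ratio $\gamma\ge0$ the efficiency $\eta=\eta(\gamma)$ for solutions of the constant-Seebeck thermoelectric equation (both defined in the context) is well defined, and it is explicitly given by $$\eta(\gamma)=\frac{\Delta T}{T_h}\,\frac{\gamma}{\gamma+1+\frac{(\gamma+1)^2}{zT_h}-\frac12\frac{\Delta T}{T_h}},$$ where $\Delta T:=T_h-T_c>0$ and $$z:=\frac{\alpha_0^2}{\frac{1}{\Delta T}\int_{T_c}^{T_h}\rho(T)\kappa(T)\,dT}.$$ The maximum efficiency is $$\eta_{\max}:=\max_{\gamma\in[0,\infty)}\eta(\gamma)=\frac{\Delta T}{T_h}\,\frac{\sqrt{1+zT_m}-1}{\sqrt{1+zT_m}+\frac{T_c}{T_h}},$$ and it is attained at a unique load ratio $\gamma=\gamma_{\mathrm{opt}}:=\sqrt{1+zT_m}$, where $T_m:=\frac12(T_h+T_c)$.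
   Context: The constant-Seebeck thermoelectric equation with load ratio $\gamma\ge 0$ is the nonlocal boundary value problem for $T\in C^2([0,L])$ (with values in $[T_c,\infty)$) $$(\kappa(T)T_x)_x+\rho(T)\,J[T]^2=0\quad\text{for }0<x<L,\qquad T(0)=T_h,\quad T(L)=T_c,$$ where $J[T]:=\frac{V}{R[T]A_c}$, $R[T]:=\frac{1+\gamma}{A_c}\int_0^L\rho(T(x))\,dx$, $V:=\alpha_0(T_h-T_c)$. The efficiency of a solution $T$ with $J[T]\neq0$ is $$\eta=\frac{\frac{\gamma}{1+\gamma}V}{\frac{-\kappa(T_h)T_x(0)}{J[T]}+\alpha_0T_h}.$$ (When $J[T]=0$ the efficiency is defined to be zero.) The efficiency is called well defined when the solution $T$ exists uniquely, so that $\eta$ depends only on the data of the equation and in particular is a function $\eta(\gamma)$ of $\gamma$. *)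

theory Defs
  imports "HOL-Analysis.Analysis"
begin

(* Derivatives are taken within S, hence one-sided at boundary points of S. *)
definition C1_on :: "real set \<Rightarrow> (real \<Rightarrow> real) \<Rightarrow> bool" where
  "C1_on S f \<longleftrightarrow>
     (\<exists>f'. (\<forall>x\<in>S. (f has_real_derivative f' x) (at x within S)) \<and> continuous_on S f')"

definition C2_on :: "real set \<Rightarrow> (real \<Rightarrow> real) \<Rightarrow> bool" where
  "C2_on S f \<longleftrightarrow>
     (\<exists>f'. (\<forall>x\<in>S. (f has_real_derivative f' x) (at x within S)) \<and> C1_on S f')"

(* T_x on [0,L], one-sided at 0 and L. *)
definition deriv_x :: "real \<Rightarrow> (real \<Rightarrow> real) \<Rightarrow> real \<Rightarrow> real" where
  "deriv_x L T x = vector_derivative T (at x within {0..L})"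

definition voltage :: "real \<Rightarrow> real \<Rightarrow> real \<Rightarrow> real" where
  "voltage Th Tc \<alpha>0 = \<alpha>0 * (Th - Tc)"

definition resistance ::
  "real \<Rightarrow> real \<Rightarrow> (real \<Rightarrow> real) \<Rightarrow> real \<Rightarrow> (real \<Rightarrow> real) \<Rightarrow> real" where
  "resistance L Ac \<rho> \<gamma> T = (1 + \<gamma>) / Ac * integral {0..L} (\<lambda>x. \<rho> (T x))"

definition current_density ::
  "real \<Rightarrow> real \<Rightarrow> real \<Rightarrow> real \<Rightarrow> real \<Rightarrow> (real \<Rightarrow> real) \<Rightarrow> real \<Rightarrow> (real \<Rightarrow> real) \<Rightarrow> real" where
  "current_density L Ac Th Tc \<alpha>0 \<rho> \<gamma> T =
     voltage Th Tc \<alpha>0 / (resistance L Ac \<rho> \<gamma> T * Ac)"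

(* Only the values of T on [0,L] matter; T is arbitrary elsewhere. *)
definition seebeck_solution ::
  "real \<Rightarrow> real \<Rightarrow> real \<Rightarrow> real \<Rightarrow> real \<Rightarrow> (real \<Rightarrow> real) \<Rightarrow> (real \<Rightarrow> real) \<Rightarrow> real \<Rightarrow>
   (real \<Rightarrow> real) \<Rightarrow> bool" where
  "seebeck_solution L Ac Th Tc \<alpha>0 \<kappa> \<rho> \<gamma> T \<longleftrightarrow>
     C2_on {0..L} T \<and> (\<forall>x\<in>{0..L}. Tc \<le> T x) \<and>
     (\<forall>x\<in>{0<..<L}. \<exists>D. ((\<lambda>y. \<kappa> (T y) * deriv_x L T y) has_real_derivative D) (at x) \<and>
        D + \<rho> (T x) * (current_density L Ac Th Tc \<alpha>0 \<rho> \<gamma> T)\<^sup>2 = 0) \<and>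
     T 0 = Th \<and> T L = Tc"

definition solution_efficiency ::
  "real \<Rightarrow> real \<Rightarrow> real \<Rightarrow> real \<Rightarrow> real \<Rightarrow> (real \<Rightarrow> real) \<Rightarrow> (real \<Rightarrow> real) \<Rightarrow> real \<Rightarrow>
   (real \<Rightarrow> real) \<Rightarrow> real" where
  "solution_efficiency L Ac Th Tc \<alpha>0 \<kappa> \<rho> \<gamma> T =
     (let J = current_density L Ac Th Tc \<alpha>0 \<rho> \<gamma> T in
      if J = 0 then 0
      else (\<gamma> / (1 + \<gamma>) * voltage Th Tc \<alpha>0) / (- \<kappa> Th * deriv_x L T 0 / J + \<alpha>0 * Th))"

(* Solutions are elements of C^2([0,L]), so uniqueness means equality on [0,L]. *)
definition efficiency_well_defined ::
  "real \<Rightarrow> real \<Rightarrow> real \<Rightarrow> real \<Rightarrow> real \<Rightarrow> (real \<Rightarrow> real) \<Rightarrow> (real \<Rightarrow> real) \<Rightarrow> real \<Rightarrow> bool" where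
  "efficiency_well_defined L Ac Th Tc \<alpha>0 \<kappa> \<rho> \<gamma> \<longleftrightarrow>
     (\<exists>T. seebeck_solution L Ac Th Tc \<alpha>0 \<kappa> \<rho> \<gamma> T) \<and>
     (\<forall>T1 T2. seebeck_solution L Ac Th Tc \<alpha>0 \<kappa> \<rho> \<gamma> T1 \<longrightarrow>
        seebeck_solution L Ac Th Tc \<alpha>0 \<kappa> \<rho> \<gamma> T2 \<longrightarrow> (\<forall>x\<in>{0..L}. T1 x = T2 x))"

(* Meaningful only under efficiency_well_defined. *)
definition efficiency ::
  "real \<Rightarrow> real \<Rightarrow> real \<Rightarrow> real \<Rightarrow> real \<Rightarrow> (real \<Rightarrow> real) \<Rightarrow> (real \<Rightarrow> real) \<Rightarrow> real \<Rightarrow> real" where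
  "efficiency L Ac Th Tc \<alpha>0 \<kappa> \<rho> \<gamma> =
     (THE e. \<exists>T. seebeck_solution L Ac Th Tc \<alpha>0 \<kappa> \<rho> \<gamma> T \<and>
        e = solution_efficiency L Ac Th Tc \<alpha>0 \<kappa> \<rho> \<gamma> T)"

end

theory Submission
  imports Defs
begin

text \<open>
  The heat equation becomes elementary once it is read along the resistance coordinate
  \<open>s(x) = (\<integral> \<rho>(T) over [0,x]) / Y\<close>, where \<open>Y\<close> is the integral of \<open>\<rho>(T)\<close> over the
  whole leg.  Since the current density \<open>J\<close> is a constant, the heat flux \<open>\<kappa>(T) T\<^sub>x\<close> is an affine
  function of \<open>s\<close>.  Multiplying it by \<open>\<rho>(T) = Y s'\<close> and integrating once more shows that
  \<open>K(T) = \<integral> \<rho> \<kappa>\<close> over \<open>[T\<^sub>c, T]\<close> is a quadratic polynomial in \<open>s\<close>: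
  \<open>K(T) = K(T\<^sub>h) (1 - s) + (c\<^sup>2/2) s (1 - s)\<close> with \<open>c = J Y = V / (1 + \<gamma>)\<close>.
  The point is that \<open>c\<close> does not depend on the unknown \<open>T\<close>, so the nonlocal term has
  disappeared: the graph of \<open>T\<close> over \<open>s\<close> is explicit (lemma \<open>first_integrals\<close>).

  To return to the position \<open>x\<close>, one solves \<open>s' = \<rho>(T) / Y\<close>, whose right-hand side is now a known
  positive function of \<open>s\<close>.  Separation of variables gives \<open>H(s) = x / Y\<close> where \<open>H\<close> is the
  integral of \<open>1 / \<rho>(T)\<close> in \<open>s\<close>, and \<open>s(L) = 1\<close> forces \<open>Y = L / H(1)\<close>.  Hence there is
  at most one solution (\<open>solution_eq_profile\<close>), and reading the construction
  backwards shows that the resulting profile is one (\<open>profile_solution\<close>).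

  The flux at \<open>x = 0\<close> comes out of the first integral, \<open>- \<kappa>(T\<^sub>h) T\<^sub>x(0) / J =
  K(T\<^sub>h) / c - c / 2\<close>, which yields the closed form of \<open>\<eta>\<close>.  With \<open>w = z T\<^sub>h\<close>,
  \<open>\<delta> = \<Delta>T / T\<^sub>h\<close> and \<open>D(\<gamma>)\<close> the denominator, completing a square gives
  \<open>D(\<gamma>) / \<gamma> = D(M) / M + (\<gamma> - M)\<^sup>2 / (w \<gamma>)\<close> for
  \<open>M = sqrt (1 + z T\<^sub>m)\<close>, so \<open>\<gamma> = M\<close> is the unique maximiser
  (\<open>load_ratio_less_optimum\<close>).
\<close>

section \<open>Primitives of positive functions and their inverses\<close>

definition signed_integral :: "(real \<Rightarrow> real) \<Rightarrow> real \<Rightarrow> real \<Rightarrow> real" where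
  "signed_integral g a t = integral {a..t} g - integral {t..a} g"

lemma signed_integral_same [simp]: "signed_integral g a a = 0"
  by (simp add: signed_integral_def)

lemma signed_integral_ge: "a \<le> t \<Longrightarrow> signed_integral g a t = integral {a..t} g"
  by (cases "t = a") (auto simp: signed_integral_def)

lemma DERIV_signed_integral:
  assumes "continuous_on UNIV g"
  shows "(signed_integral g a has_real_derivative g t) (at t)"
proof -
  \<comment> \<open>Around \<open>t\<close> the function differs by a constant from the integral over \<open>[b, x]\<close>, with \<open>b\<close> to the
    left of both \<open>a\<close> and \<open>t\<close>.\<close>
  define b where "b = min a t - 1"
  define d where "d = t + 1"
  have int: "g integrable_on {u..v}" for u v
    by (intro integrable_continuous_real continuous_on_subset[OF assms]) auto
  have t: "t \<in> {b<..<d}" "b \<le> a"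
    by (auto simp: b_def d_def)
  have "((\<lambda>x. integral {b..x} g) has_real_derivative g t) (at t within {b..d})"
    using t by (intro integral_has_real_derivative continuous_on_subset[OF assms]) auto
  then have "((\<lambda>x. integral {b..x} g) has_real_derivative g t) (at t)"
    using t by (metis at_within_Icc_at greaterThanLessThan_iff)
  then have "((\<lambda>x. integral {b..x} g - integral {b..a} g) has_real_derivative g t) (at t)"
    by (auto intro!: derivative_eq_intros)
  then show ?thesis
  proof (rule has_field_derivative_transform_within_open)
    fix x assume x: "x \<in> {b<..<d}"
    show "integral {b..x} g - integral {b..a} g = signed_integral g a x"
    proof (cases "a \<le> x")
      case True
      then have "integral {b..a} g + integral {a..x} g = integral {b..x} g"
        using t by (intro Henstock_Kurzweil_Integration.integral_combine int) auto
      then show ?thesis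
        using True by (simp add: signed_integral_ge)
    next
      case False
      then have "integral {b..x} g + integral {x..a} g = integral {b..a} g"
        using x by (intro Henstock_Kurzweil_Integration.integral_combine int) auto
      then show ?thesis
        using False by (simp add: signed_integral_def)
    qed
  qed (use t in auto)
qed

lemma continuous_on_of_DERIV:
  fixes G :: "real \<Rightarrow> real"
  assumes "\<And>t. (G has_real_derivative g t) (at t)"
  shows "continuous_on A G"
  by (rule DERIV_continuous_on, rule has_field_derivative_at_within, rule assms)

lemma filterlim_at_top_of_DERIV_ge:
  fixes G :: "real \<Rightarrow> real"
  assumes deriv: "\<And>t. (G has_real_derivative g t) (at t)"
    and "m > 0" and ge: "\<And>t. t \<ge> a \<Longrightarrow> g t \<ge> m"
  shows "filterlim G at_top at_top"
proof -
  have lower: "G a + m * (t - a) \<le> G t" if "t \<ge> a" for t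
  proof -
    have "\<exists>y. ((\<lambda>u. G u - m * (u - a)) has_real_derivative y) (at x) \<and> 0 \<le> y"
      if "a \<le> x" for x
    proof (intro exI conjI)
      show "((\<lambda>u. G u - m * (u - a)) has_real_derivative g x - m * (1 - 0)) (at x)"
        by (intro DERIV_diff deriv DERIV_cmult DERIV_ident DERIV_const)
      show "0 \<le> g x - m * (1 - 0)"
        using ge[OF that] by simp
    qed
    then have "G a - m * (a - a) \<le> G t - m * (t - a)"
      by (intro DERIV_nonneg_imp_nondecreasing[OF \<open>t \<ge> a\<close>]) blast
    then show ?thesis by simp
  qed
  have "G t \<ge> Z" if "t \<ge> max a (a + (Z - G a) / m)" for t Z
  proof -
    have "(Z - G a) / m \<le> t - a"
      using that by auto
    then have "Z - G a \<le> m * (t - a)"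
      using \<open>m > 0\<close> by (simp add: field_simps)
    then show ?thesis
      using lower[of t] that by auto
  qed
  then show ?thesis
    unfolding filterlim_at_top eventually_at_top_linorder by blast
qed

lemma filterlim_at_bot_of_DERIV_ge:
  fixes G :: "real \<Rightarrow> real"
  assumes deriv: "\<And>t. (G has_real_derivative g t) (at t)"
    and "m > 0" and ge: "\<And>t. t \<le> a \<Longrightarrow> g t \<ge> m"
  shows "filterlim G at_bot at_bot"
proof -
  have "((\<lambda>t. - G (- t)) has_real_derivative g (- t)) (at t)" for t
    using DERIV_minus[OF DERIV_chain2[OF deriv DERIV_minus[OF DERIV_ident]]] by simp
  then have "filterlim (\<lambda>t. - G (- t)) at_top at_top"
    by (rule filterlim_at_top_of_DERIV_ge[OF _ \<open>m > 0\<close>, of _ _ "- a"]) (auto intro: ge)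
  then have "filterlim (\<lambda>t. G (- t)) at_bot at_top"
    by (rule filterlim_uminus_at_bot[THEN iffD2])
  then show ?thesis
    by (rule filterlim_at_bot_mirror[THEN iffD2])
qed

lemma strict_mono_of_DERIV_pos:
  fixes G :: "real \<Rightarrow> real"
  assumes "\<And>t. (G has_real_derivative g t) (at t)" "\<And>t. g t > 0"
  shows "strict_mono G"
proof (rule strict_monoI)
  fix x y :: real assume "x < y"
  then show "G x < G y"
    by (rule DERIV_pos_imp_increasing) (meson assms)
qed

lemma surj_of_continuous_unbounded:
  fixes G :: "real \<Rightarrow> real"
  assumes cont: "continuous_on UNIV G"
    and top: "filterlim G at_top at_top" and bot: "filterlim G at_bot at_bot"
  shows "surj G"
proof -
  have "\<exists>x. y = G x" for y
  proof -
    obtain u where u: "y \<le> G t" if "t \<ge> u" for t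
      using top unfolding filterlim_at_top eventually_at_top_linorder by metis
    obtain v where v: "G t \<le> y" if "t \<le> v" for t
      using bot unfolding filterlim_at_bot eventually_at_bot_linorder by metis
    have "\<exists>x. min u v \<le> x \<and> x \<le> max u v \<and> G x = y"
      by (rule IVT') (auto intro: u v continuous_on_subset[OF cont])
    then show ?thesis by auto
  qed
  then show ?thesis
    unfolding surj_def by blast
qed

lemma DERIV_inv_of_DERIV_pos:
  fixes G :: "real \<Rightarrow> real"
  assumes deriv: "\<And>t. (G has_real_derivative g t) (at t)" and pos: "\<And>t. g t > 0"
    and "surj G"
  shows "(inv G has_real_derivative 1 / g (inv G y)) (at y)"
proof -
  have inj: "inj G"
    using strict_mono_of_DERIV_pos[OF deriv pos] by (rule strict_mono_imp_inj_on)
  have "(inv G has_derivative (*) (inverse (g (inv G y)))) (at (G (inv G y)))"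
  proof (rule has_derivative_inverse_strong[of UNIV "inv G y" G])
    show "continuous_on UNIV G"
      using deriv by (rule continuous_on_of_DERIV)
    show "(G has_derivative (*) (g (inv G y))) (at (inv G y))"
      using deriv by (simp add: has_field_derivative_def)
    show "(*) (g (inv G y)) \<circ> (*) (inverse (g (inv G y))) = id"
      using pos[of "inv G y"] by (auto simp: fun_eq_iff)
  qed (auto simp: inj)
  then show ?thesis
    by (simp add: has_field_derivative_def surj_f_inv_f[OF \<open>surj G\<close>] inverse_eq_divide)
qed

lemma constant_on_Icc_of_DERIV_zero:
  fixes f :: "real \<Rightarrow> real"
  assumes "\<And>x. x \<in> {a..b} \<Longrightarrow> (f has_real_derivative 0) (at x within {a..b})"
    and "x \<in> {a..b}"
  shows "f x = f a"
proof -
  obtain C where "\<forall>x\<in>{a..b}. f x = C"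
    using has_field_derivative_zero_constant[of "{a..b}" f] assms(1) by auto
  then show ?thesis
    using assms(2) by auto
qed

section \<open>The boundary value problem in the resistance coordinate\<close>

text \<open>
  The material functions live on \<open>[T\<^sub>c, \<infinity>)\<close> only and the coordinate \<open>s\<close> on \<open>[0,1]\<close>.  Freezing
  the arguments at the ends of these intervals makes the primitives below increasing bijections
  of the real line, so that their inverses are differentiable everywhere, including at the
  points that correspond to the cold end.
\<close>

locale thermoelectric_leg =
  fixes L Ac Th Tc \<alpha>0 :: real and \<kappa> \<rho> :: "real \<Rightarrow> real" and \<gamma> :: real
  assumes L: "L > 0" and Ac: "Ac > 0" and Th: "Th > Tc" and \<alpha>0: "\<alpha>0 \<noteq> 0"
    and \<kappa>_C1: "C1_on {Tc..} \<kappa>" and \<kappa>_pos: "\<And>t. t \<ge> Tc \<Longrightarrow> \<kappa> t > 0"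
    and \<rho>_cont: "continuous_on {Tc..} \<rho>" and \<rho>_pos: "\<And>t. t \<ge> Tc \<Longrightarrow> \<rho> t > 0"
    and diverges: "filterlim (\<lambda>b. integral {Tc..b} (\<lambda>t. \<rho> t * \<kappa> t)) at_top at_top"
    and \<gamma>: "\<gamma> \<ge> 0"
begin

abbreviation "solution \<equiv> seebeck_solution L Ac Th Tc \<alpha>0 \<kappa> \<rho> \<gamma>"
abbreviation "current \<equiv> current_density L Ac Th Tc \<alpha>0 \<rho> \<gamma>"

definition "k t = \<rho> (max Tc t) * \<kappa> (max Tc t)"
definition "K = signed_integral k Tc"

text \<open>The voltage drop across the internal resistance, which is \<open>J\<close> times the integral of
  \<open>\<rho>(T)\<close> whatever the temperature is.\<close>
definition "c = voltage Th Tc \<alpha>0 / (1 + \<gamma>)"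

text \<open>\<open>P\<close> is \<open>K(T)\<close> and \<open>P' / Y\<close> is \<open>\<kappa>(T) T\<^sub>x\<close> along a solution, as functions of \<open>s\<close>.\<close>
definition "P s = K Th * (1 - s) + c\<^sup>2 / 2 * (s * (1 - s))"
definition "P' s = - K Th + c\<^sup>2 / 2 - c\<^sup>2 * s"
definition "temp s = inv K (P s)"
definition "h s = 1 / \<rho> (max Tc (temp (max 0 (min 1 s))))"
definition "H = signed_integral h 0"
definition "Y = L / H 1"
definition "S x = inv H (x / Y)"
definition "profile x = temp (S x)"

lemma \<kappa>_cont: "continuous_on {Tc..} \<kappa>"
  using \<kappa>_C1 unfolding C1_on_def by (meson DERIV_continuous_on)

lemma k_pos: "k t > 0"
  unfolding k_def by (intro mult_pos_pos \<rho>_pos \<kappa>_pos) auto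

lemma DERIV_K: "(K has_real_derivative k t) (at t)"
  unfolding K_def k_def
  by (intro DERIV_signed_integral continuous_intros continuous_on_compose2[OF \<rho>_cont]
      continuous_on_compose2[OF \<kappa>_cont]) auto

lemma K_Tc: "K Tc = 0"
  by (simp add: K_def)

lemma K_eq_integral:
  assumes "t \<ge> Tc"
  shows "K t = integral {Tc..t} (\<lambda>t. \<rho> t * \<kappa> t)"
  unfolding K_def signed_integral_ge[OF assms]
  by (rule integral_cong) (auto simp: k_def max_def)

lemma strict_mono_K: "strict_mono K"
  by (rule strict_mono_of_DERIV_pos[OF DERIV_K k_pos])

lemma K_Th_pos: "K Th > 0"
  using strict_monoD[OF strict_mono_K Th] by (simp add: K_Tc)

lemma surj_K: "surj K"
proof (rule surj_of_continuous_unbounded)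
  show "continuous_on UNIV K"
    using DERIV_K by (rule continuous_on_of_DERIV)
  have "\<forall>\<^sub>F b in at_top. integral {Tc..b} (\<lambda>t. \<rho> t * \<kappa> t) = K b"
    using eventually_ge_at_top[of Tc] by eventually_elim (simp add: K_eq_integral)
  then show "filterlim K at_top at_top"
    using diverges by (simp cong: filterlim_cong)
  show "filterlim K at_bot at_bot"
    by (rule filterlim_at_bot_of_DERIV_ge[OF DERIV_K k_pos[of Tc], of Tc]) (simp add: k_def)
qed

lemma inv_K_K: "inv K (K t) = t"
  by (simp add: inv_f_f strict_mono_imp_inj_on[OF strict_mono_K])

lemma K_inv_K: "K (inv K y) = y"
  by (rule surj_f_inv_f[OF surj_K])

lemma DERIV_P: "(P has_real_derivative P' s) (at s)"
  unfolding P_def[abs_def] P'_def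
  by (auto intro!: derivative_eq_intros simp: field_simps)

lemma P_nonneg: "s \<in> {0..1} \<Longrightarrow> P s \<ge> 0"
  unfolding P_def using K_Th_pos by (intro add_nonneg_nonneg mult_nonneg_nonneg) auto

lemma DERIV_temp: "(temp has_real_derivative P' s / k (temp s)) (at s)"
  unfolding temp_def
  using DERIV_chain2[OF DERIV_inv_of_DERIV_pos[OF DERIV_K k_pos surj_K] DERIV_P] by simp

lemma temp_0: "temp 0 = Th" and temp_1: "temp 1 = Tc"
  using inv_K_K[of Th] inv_K_K[of Tc] by (auto simp: temp_def P_def K_Tc)

lemma temp_ge:
  assumes "s \<in> {0..1}"
  shows "temp s \<ge> Tc"
proof -
  have "K Tc \<le> K (temp s)"
    using P_nonneg[OF assms] by (simp add: temp_def K_inv_K K_Tc)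
  then show ?thesis
    using strict_mono_K by (simp add: strict_mono_less_eq)
qed

lemma h_pos: "h s > 0"
  by (auto simp: h_def intro!: \<rho>_pos)

lemma h_eq: "s \<in> {0..1} \<Longrightarrow> h s = 1 / \<rho> (temp s)"
  using temp_ge[of s] by (auto simp: h_def max_def min_def)

lemma DERIV_H: "(H has_real_derivative h s) (at s)"
proof -
  have temp: "continuous_on UNIV temp"
    using DERIV_temp by (rule continuous_on_of_DERIV)
  have ne: "\<rho> (max Tc (temp (max 0 (min 1 s)))) \<noteq> 0" for s
    using \<rho>_pos[of "max Tc (temp (max 0 (min 1 s)))"] by auto
  show ?thesis
    unfolding H_def h_def using ne
    by (intro DERIV_signed_integral continuous_intros continuous_on_compose2[OF \<rho>_cont]
        continuous_on_compose2[OF temp]) auto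
qed

lemma strict_mono_H: "strict_mono H"
  by (rule strict_mono_of_DERIV_pos[OF DERIV_H h_pos])

lemma H_0: "H 0 = 0"
  by (simp add: H_def)

lemma H_1_pos: "H 1 > 0"
  using strict_monoD[OF strict_mono_H, of 0 1] by (simp add: H_0)

lemma surj_H: "surj H"
proof (rule surj_of_continuous_unbounded)
  show "continuous_on UNIV H"
    using DERIV_H by (rule continuous_on_of_DERIV)
  show "filterlim H at_top at_top"
    by (rule filterlim_at_top_of_DERIV_ge[OF DERIV_H h_pos[of 1], of 1]) (simp add: h_def)
  show "filterlim H at_bot at_bot"
    by (rule filterlim_at_bot_of_DERIV_ge[OF DERIV_H h_pos[of 0], of 0]) (simp add: h_def)
qed

lemma inv_H_H: "inv H (H s) = s"
  by (simp add: inv_f_f strict_mono_imp_inj_on[OF strict_mono_H])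

lemma H_inv_H: "H (inv H y) = y"
  by (rule surj_f_inv_f[OF surj_H])

lemma Y_pos: "Y > 0"
  using L H_1_pos by (simp add: Y_def)

lemma c_nonzero: "c \<noteq> 0"
  using \<alpha>0 Th \<gamma> by (simp add: c_def voltage_def)

lemma current_eq: "current T = c / integral {0..L} (\<lambda>x. \<rho> (T x))"
  using Ac by (simp add: current_density_def resistance_def c_def)

lemma deriv_x_eq:
  assumes "x \<in> {0..L}" "(T has_real_derivative D) (at x within {0..L})"
  shows "deriv_x L T x = D"
  unfolding deriv_x_def
  using assms L
  by (intro vector_derivative_within_closed_interval)
     (auto simp: has_real_derivative_iff_has_vector_derivative)

section \<open>Uniqueness\<close>

text \<open>
  Joule heating is \<open>J\<^sup>2\<close> times the derivative of \<open>y(x) = \<integral> \<rho>(T)\<close>, so the flux plus \<open>J\<^sup>2 y\<close> is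
  constant; multiplying the flux by \<open>y' = \<rho>(T)\<close> turns it into the derivative of \<open>K(T)\<close>.  The
  boundary value \<open>K(T(L)) = 0\<close> determines the constant of integration.
\<close>

lemma first_integrals:
  assumes sol: "solution T"
  defines "R \<equiv> integral {0..L} (\<lambda>x. \<rho> (T x))"
  defines "s \<equiv> \<lambda>x. integral {0..x} (\<lambda>x. \<rho> (T x)) / R"
  shows "R > 0"
    and "\<And>x. x \<in> {0..L} \<Longrightarrow> s x \<in> {0..1}"
    and "\<And>x. x \<in> {0..L} \<Longrightarrow> (s has_real_derivative \<rho> (T x) / R) (at x within {0..L})"
    and "\<And>x. x \<in> {0..L} \<Longrightarrow> T x = temp (s x)"
    and "\<And>x. x \<in> {0..L} \<Longrightarrow> \<kappa> (T x) * deriv_x L T x = P' (s x) / R"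
proof -
  define y where "y = (\<lambda>x. integral {0..x} (\<lambda>x. \<rho> (T x)))"
  define J where "J = current T"
  define q where "q = (\<lambda>x. \<kappa> (T x) * deriv_x L T x)"
  obtain T' where T': "\<And>x. x \<in> {0..L} \<Longrightarrow> (T has_real_derivative T' x) (at x within {0..L})"
    and T'_C1: "C1_on {0..L} T'"
    using sol unfolding seebeck_solution_def C2_on_def by blast
  have T'_cont: "continuous_on {0..L} T'"
    using T'_C1 unfolding C1_on_def by (meson DERIV_continuous_on)
  have T_cont: "continuous_on {0..L} T"
    using T' by (rule DERIV_continuous_on)
  have T_ge: "T x \<ge> Tc" if "x \<in> {0..L}" for x
    using sol that unfolding seebeck_solution_def by auto
  have T_ends: "T 0 = Th" "T L = Tc"
    using sol unfolding seebeck_solution_def by auto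
  have q_eq: "q x = \<kappa> (T x) * T' x" if "x \<in> {0..L}" for x
    using deriv_x_eq[OF that T'[OF that]] by (simp add: q_def)
  have \<rho>T_cont: "continuous_on {0..L} (\<lambda>x. \<rho> (T x))"
    using T_ge by (intro continuous_on_compose2[OF \<rho>_cont T_cont]) auto
  have q_cont: "continuous_on {0..L} q"
  proof -
    have "continuous_on {0..L} (\<lambda>x. \<kappa> (T x) * T' x)"
      using T_ge by (intro continuous_intros continuous_on_compose2[OF \<kappa>_cont T_cont] T'_cont) auto
    then show ?thesis
      by (rule continuous_on_eq) (simp add: q_eq)
  qed
  have DERIV_y: "(y has_real_derivative \<rho> (T x)) (at x within {0..L})" if "x \<in> {0..L}" for x
    unfolding y_def using that by (rule integral_has_real_derivative[OF \<rho>T_cont])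
  have y_cont: "continuous_on {0..L} y"
    using DERIV_y by (rule DERIV_continuous_on)
  have y_0: "y 0 = 0" and y_L: "y L = R"
    by (auto simp: y_def R_def)
  have interior: "(f has_real_derivative D) (at x)"
    if "(f has_real_derivative D) (at x within {0..L})" "0 < x" "x < L" for f D x
    using that by (simp add: at_within_Icc_at)
  have y_less: "y a < y b" if "0 \<le> a" "a < b" "b \<le> L" for a b
  proof (rule DERIV_pos_imp_increasing_open[OF \<open>a < b\<close>])
    show "\<exists>d. (y has_real_derivative d) (at x) \<and> d > 0" if "a < x" "x < b" for x
      using interior[OF DERIV_y, of x] \<rho>_pos[OF T_ge, of x] that \<open>0 \<le> a\<close> \<open>b \<le> L\<close> by auto
    show "continuous_on {a..b} y"
      using that by (intro continuous_on_subset[OF y_cont]) auto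
  qed
  show R_pos: "R > 0"
    using y_less[of 0 L] L by (simp add: y_0 y_L)
  have s_eq: "s x = y x / R" for x
    by (simp add: s_def y_def)
  show s_range: "s x \<in> {0..1}" if "x \<in> {0..L}" for x
  proof -
    have "y 0 \<le> y x" "y x \<le> y L"
      using y_less[of 0 x] y_less[of x L] that by (cases "x = 0"; cases "x = L"; auto)+
    then show ?thesis
      using R_pos by (simp add: s_eq y_0 y_L)
  qed
  show DERIV_s: "(s has_real_derivative \<rho> (T x) / R) (at x within {0..L})"
    if "x \<in> {0..L}" for x
    using DERIV_cdivide[OF DERIV_y[OF that], of R] by (simp add: s_eq[abs_def])
  have J_eq: "J = c / R"
    by (simp add: J_def R_def current_eq)
  have flux: "q x = q 0 - J\<^sup>2 * y x" if x: "x \<in> {0..L}" for x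
  proof -
    have "q x + J\<^sup>2 * y x = q 0 + J\<^sup>2 * y 0"
    proof (rule DERIV_isconst2[OF L])
      show "continuous_on {0..L} (\<lambda>x. q x + J\<^sup>2 * y x)"
        by (intro continuous_intros q_cont y_cont)
      fix u assume u: "0 < u" "u < L"
      obtain D where D: "(q has_real_derivative D) (at u)" "D + \<rho> (T u) * J\<^sup>2 = 0"
        using sol u unfolding seebeck_solution_def q_def J_def
        by (meson greaterThanLessThan_iff)
      have "((\<lambda>x. q x + J\<^sup>2 * y x) has_real_derivative D + J\<^sup>2 * \<rho> (T u)) (at u)"
        using interior[OF DERIV_y, of u] u by (intro DERIV_add D DERIV_cmult) auto
      then show "((\<lambda>x. q x + J\<^sup>2 * y x) has_real_derivative 0) (at u)"
        using D(2) by (simp add: mult.commute)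
    qed (use x in auto)
    then show ?thesis by (simp add: y_0)
  qed
  have energy: "K (T x) = K Th + q 0 * y x - J\<^sup>2 / 2 * (y x)\<^sup>2" if x: "x \<in> {0..L}" for x
  proof -
    have "((\<lambda>x. K (T x) - q 0 * y x + J\<^sup>2 / 2 * (y x)\<^sup>2) has_real_derivative 0)
        (at u within {0..L})" if u: "u \<in> {0..L}" for u
    proof -
      have "k (T u) * T' u = \<rho> (T u) * q u"
        using T_ge[OF u] by (simp add: k_def q_eq[OF u] max_def)
      then have zero: "k (T u) * T' u - q 0 * \<rho> (T u) + J\<^sup>2 * y u * \<rho> (T u) = 0"
        by (simp add: flux[OF u] algebra_simps)
      show ?thesis
        by (rule derivative_eq_intros DERIV_chain2[OF DERIV_K T'[OF u]] DERIV_y[OF u] refl)+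
           (use zero in \<open>simp add: algebra_simps\<close>)
    qed
    from constant_on_Icc_of_DERIV_zero[OF this x] show ?thesis
      by (simp add: y_0 T_ends)
  qed
  have q_0: "q 0 = (- K Th + c\<^sup>2 / 2) / R"
  proof -
    have "0 = K Th + q 0 * R - c\<^sup>2 / 2"
      using energy[of L] L R_pos by (simp add: T_ends K_Tc y_L J_eq power_divide)
    then show ?thesis
      using R_pos by (simp add: field_simps)
  qed
  show "\<kappa> (T x) * deriv_x L T x = P' (s x) / R" if x: "x \<in> {0..L}" for x
    using flux[OF x] unfolding q_0
    by (simp add: q_def J_eq P'_def s_eq diff_divide_distrib power2_eq_square)
  show "T x = temp (s x)" if x: "x \<in> {0..L}" for x
  proof -
    have "K (T x) = P (s x)"
      using energy[OF x] R_pos unfolding q_0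
      by (simp add: J_eq P_def s_eq field_simps power2_eq_square)
    then show ?thesis
      using inv_K_K[of "T x"] by (simp add: temp_def)
  qed
qed

text \<open>Along any solution the derivative of \<open>H(s(x))\<close> is \<open>1 / \<rho>(T)\<close> times \<open>\<rho>(T) / R\<close>, a constant.
  Evaluation at \<open>x = L\<close> then determines \<open>R\<close>, and with it \<open>s\<close> and \<open>T\<close>.\<close>

lemma solution_eq_profile:
  assumes sol: "solution T" and x: "x \<in> {0..L}"
  shows "T x = profile x"
proof -
  define R where "R = integral {0..L} (\<lambda>x. \<rho> (T x))"
  define s where "s x = integral {0..x} (\<lambda>x. \<rho> (T x)) / R" for x
  note fi = first_integrals[OF sol, folded R_def, folded s_def]
  have H_s: "H (s x) = x / R" if x: "x \<in> {0..L}" for x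
  proof -
    have "((\<lambda>x. H (s x) - x / R) has_real_derivative 0) (at u within {0..L})"
      if u: "u \<in> {0..L}" for u
    proof -
      have "\<rho> (T u) > 0"
        using temp_ge[OF fi(2)[OF u]] fi(4)[OF u] by (auto intro: \<rho>_pos)
      then have "h (s u) * (\<rho> (T u) / R) - 1 / R = 0"
        using h_eq[OF fi(2)[OF u]] fi(4)[OF u] by simp
      moreover have "((\<lambda>x. H (s x) - x / R) has_real_derivative
          h (s u) * (\<rho> (T u) / R) - 1 / R) (at u within {0..L})"
        by (intro DERIV_diff DERIV_chain2[OF DERIV_H fi(3)[OF u]] DERIV_cdivide DERIV_ident)
      ultimately show ?thesis by (simp only:)
    qed
    from constant_on_Icc_of_DERIV_zero[OF this x] show ?thesis
      by (simp add: s_def H_0)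
  qed
  have "s L = 1"
    using fi(1) by (simp add: s_def R_def)
  then have "R = Y"
    using H_s[of L] L H_1_pos fi(1) by (simp add: Y_def field_simps)
  then have "S x = s x"
    using H_s[OF x] inv_H_H[of "s x"] by (simp add: S_def)
  then show ?thesis
    using fi(4)[OF x] by (simp add: profile_def)
qed

section \<open>Existence\<close>

lemma DERIV_S: "(S has_real_derivative 1 / h (S x) / Y) (at x)"
  unfolding S_def
  using DERIV_chain2[OF DERIV_inv_of_DERIV_pos[OF DERIV_H h_pos surj_H]
      DERIV_cdivide[OF DERIV_ident]] by simp

lemma S_0: "S 0 = 0" and S_L: "S L = 1"
  using inv_H_H[of 0] inv_H_H[of 1] L H_1_pos by (auto simp: S_def H_0 Y_def)

lemma S_range:
  assumes "x \<in> {0..L}"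
  shows "S x \<in> {0..1}"
proof -
  have "H 0 \<le> H (S x)" "H (S x) \<le> H 1"
    using assms Y_pos L H_1_pos by (auto simp: S_def H_inv_H H_0 Y_def field_simps)
  then show ?thesis
    using strict_mono_H by (simp add: strict_mono_less_eq)
qed

lemma profile_ge: "x \<in> {0..L} \<Longrightarrow> profile x \<ge> Tc"
  unfolding profile_def by (intro temp_ge S_range)

lemma DERIV_S_on:
  assumes "x \<in> {0..L}"
  shows "(S has_real_derivative \<rho> (profile x) / Y) (at x)"
  using DERIV_S[of x] by (simp add: h_eq[OF S_range[OF assms]] profile_def)

lemma DERIV_profile:
  assumes x: "x \<in> {0..L}"
  shows "(profile has_real_derivative P' (S x) / (Y * \<kappa> (profile x))) (at x)"
proof -
  have "(profile has_real_derivative P' (S x) / k (temp (S x)) * (\<rho> (profile x) / Y)) (at x)"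
    unfolding profile_def[abs_def]
    using DERIV_chain2[OF DERIV_temp DERIV_S_on[OF x]] by (simp add: profile_def)
  moreover have "P' (S x) / k (temp (S x)) * (\<rho> (profile x) / Y) = P' (S x) / (Y * \<kappa> (profile x))"
    using profile_ge[OF x] \<rho>_pos[OF profile_ge[OF x]]
    by (simp add: k_def profile_def max_def field_simps)
  ultimately show ?thesis by simp
qed

lemma C2_profile: "C2_on {0..L} profile"
proof -
  obtain \<kappa>' where \<kappa>': "\<And>t. t \<ge> Tc \<Longrightarrow> (\<kappa> has_real_derivative \<kappa>' t) (at t within {Tc..})"
    and \<kappa>'_cont: "continuous_on {Tc..} \<kappa>'"
    using \<kappa>_C1 unfolding C1_on_def by auto
  define T' where "T' = (\<lambda>x. P' (S x) / (Y * \<kappa> (profile x)))"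
  define T'' where "T'' = (\<lambda>x. (- (c\<^sup>2 * (\<rho> (profile x) / Y)) * (Y * \<kappa> (profile x))
      - P' (S x) * (Y * (\<kappa>' (profile x) * T' x))) / (Y * \<kappa> (profile x))\<^sup>2)"
  have \<kappa>_ne: "Y * \<kappa> (profile x) \<noteq> 0" if "x \<in> {0..L}" for x
    using \<kappa>_pos[OF profile_ge[OF that]] Y_pos by auto
  have T': "(profile has_real_derivative T' x) (at x within {0..L})" if "x \<in> {0..L}" for x
    unfolding T'_def using DERIV_profile[OF that] by (rule has_field_derivative_at_within)
  have T'': "(T' has_real_derivative T'' x) (at x within {0..L})" if x: "x \<in> {0..L}" for x
  proof -
    have S: "(S has_real_derivative \<rho> (profile x) / Y) (at x within {0..L})"
      using DERIV_S_on[OF x] by (rule has_field_derivative_at_within)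
    have num: "((\<lambda>x. P' (S x)) has_real_derivative - (c\<^sup>2 * (\<rho> (profile x) / Y))) (at x within {0..L})"
      unfolding P'_def by (rule derivative_eq_intros S refl)+ simp
    \<comment> \<open>At \<open>x = L\<close> the derivative of \<open>\<kappa>\<close> is one-sided, but the profile stays on that side.\<close>
    have "(\<kappa> has_real_derivative \<kappa>' (profile x)) (at (profile x) within profile ` {0..L})"
      using profile_ge by (intro has_field_derivative_subset[OF \<kappa>'[OF profile_ge[OF x]]]) auto
    from DERIV_image_chain[OF this T'[OF x]]
    have "((\<lambda>x. \<kappa> (profile x)) has_real_derivative \<kappa>' (profile x) * T' x) (at x within {0..L})"
      by (simp add: o_def)
    from DERIV_divide[OF num DERIV_cmult[OF this] \<kappa>_ne[OF x]] show ?thesis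
      by (simp add: T'_def T''_def power2_eq_square)
  qed
  have prof: "continuous_on {0..L} profile"
    using T' by (rule DERIV_continuous_on)
  have T'_cont: "continuous_on {0..L} T'"
    using T'' by (rule DERIV_continuous_on)
  have S: "continuous_on {0..L} S"
    using DERIV_S by (rule continuous_on_of_DERIV)
  have "continuous_on {0..L} T''"
    unfolding T''_def P'_def using profile_ge \<kappa>_ne Y_pos
    by (intro continuous_intros T'_cont S continuous_on_compose2[OF \<rho>_cont prof]
        continuous_on_compose2[OF \<kappa>_cont prof] continuous_on_compose2[OF \<kappa>'_cont prof])
       auto
  then show ?thesis
    unfolding C2_on_def C1_on_def using T' T'' by blast
qed

text \<open>Since \<open>\<rho>(T) = Y S'\<close> along the profile, the integral of \<open>\<rho>(T)\<close> is \<open>Y\<close>: this is the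
  self-consistency that the nonlocal coefficient \<open>J\<close> demands.\<close>

lemma current_profile: "current profile = c / Y"
proof -
  have "((\<lambda>x. \<rho> (profile x)) has_integral Y * S L - Y * S 0) {0..L}"
  proof (rule fundamental_theorem_of_calculus)
    show "((\<lambda>x. Y * S x) has_vector_derivative \<rho> (profile x)) (at x within {0..L})"
      if "x \<in> {0..L}" for x
      using DERIV_cmult[OF has_field_derivative_at_within[OF DERIV_S_on[OF that]], of Y "{0..L}"] Y_pos
      by (simp add: has_real_derivative_iff_has_vector_derivative)
  qed (use L in simp)
  then have "integral {0..L} (\<lambda>x. \<rho> (profile x)) = Y"
    by (simp add: integral_unique S_0 S_L)
  then show ?thesis
    by (simp add: current_eq)
qed

lemma profile_solution: "solution profile"
  unfolding seebeck_solution_def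
proof (intro conjI ballI)
  show "profile 0 = Th" "profile L = Tc"
    by (auto simp: profile_def S_0 S_L temp_0 temp_1)
  fix x assume x: "x \<in> {0<..<L}"
  have flux: "P' (S u) / Y = \<kappa> (profile u) * deriv_x L profile u" if "u \<in> {0<..<L}" for u
  proof -
    have u: "u \<in> {0..L}"
      using that by auto
    show ?thesis
      using deriv_x_eq[OF u has_field_derivative_at_within[OF DERIV_profile[OF u]]]
        \<kappa>_pos[OF profile_ge[OF u]] Y_pos by simp
  qed
  have x': "x \<in> {0..L}"
    using x by auto
  have "((\<lambda>u. P' (S u) / Y) has_real_derivative - (c\<^sup>2 * (\<rho> (profile x) / Y)) / Y) (at x)"
    unfolding P'_def by (rule derivative_eq_intros DERIV_S_on[OF x'] refl)+ (use Y_pos in \<open>simp_all add: field_simps\<close>)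
  then have "((\<lambda>u. \<kappa> (profile u) * deriv_x L profile u) has_real_derivative
      - (c\<^sup>2 * (\<rho> (profile x) / Y)) / Y) (at x)"
    by (rule has_field_derivative_transform_within_open[where S = "{0<..<L}"])
       (use x flux in auto)
  moreover have "- (c\<^sup>2 * (\<rho> (profile x) / Y)) / Y + \<rho> (profile x) * (current profile)\<^sup>2 = 0"
    by (simp add: current_profile power2_eq_square)
  ultimately show "\<exists>D. ((\<lambda>u. \<kappa> (profile u) * deriv_x L profile u) has_real_derivative D) (at x) \<and>
      D + \<rho> (profile x) * (current profile)\<^sup>2 = 0"
    by blast
qed (auto intro: C2_profile profile_ge)

lemma well_defined: "efficiency_well_defined L Ac Th Tc \<alpha>0 \<kappa> \<rho> \<gamma>"
  unfolding efficiency_well_defined_def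
  using profile_solution solution_eq_profile by metis

section \<open>The efficiency\<close>

lemma solution_efficiency_eq:
  assumes sol: "solution T"
  shows "solution_efficiency L Ac Th Tc \<alpha>0 \<kappa> \<rho> \<gamma> T =
    \<gamma> * c / (K Th / c - c / 2 + \<alpha>0 * Th)"
proof -
  define R where "R = integral {0..L} (\<lambda>x. \<rho> (T x))"
  note fi = first_integrals[OF sol, folded R_def]
  have "T 0 = Th"
    using sol unfolding seebeck_solution_def by auto
  then have flux: "\<kappa> Th * deriv_x L T 0 = (- K Th + c\<^sup>2 / 2) / R"
    using fi(5)[of 0] L by (simp add: P'_def)
  have J: "current T = c / R"
    by (simp add: current_eq R_def)
  have heat: "- \<kappa> Th * deriv_x L T 0 / (c / R) = K Th / c - c / 2"
  proof -
    have "- \<kappa> Th * deriv_x L T 0 / (c / R) = - ((- K Th + c\<^sup>2 / 2) / R) / (c / R)"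
      using flux by simp
    also have "\<dots> = K Th / c - c / 2"
      using fi(1) c_nonzero by (simp add: field_simps power2_eq_square)
    finally show ?thesis .
  qed
  show ?thesis
    unfolding solution_efficiency_def Let_def J heat
    using c_nonzero fi(1) by (simp add: c_def)
qed

lemma efficiency_eq:
  "efficiency L Ac Th Tc \<alpha>0 \<kappa> \<rho> \<gamma> = \<gamma> * c / (K Th / c - c / 2 + \<alpha>0 * Th)"
  unfolding efficiency_def
  using profile_solution by (intro the_equality) (auto simp: solution_efficiency_eq)

text \<open>Since \<open>c\<close> is proportional to \<open>\<alpha>\<^sub>0\<close> and \<open>K(T\<^sub>h) = \<alpha>\<^sub>0\<^sup>2 \<Delta>T / z\<close>, numerator and denominator have
  the common factor \<open>\<alpha>\<^sub>0\<close>, whose sign thus does not matter.\<close>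

lemma efficiency_closed_form:
  assumes "Th > 0"
  defines "z \<equiv> \<alpha>0\<^sup>2 / (1 / (Th - Tc) * integral {Tc..Th} (\<lambda>t. \<rho> t * \<kappa> t))"
  shows "z > 0"
    and "efficiency L Ac Th Tc \<alpha>0 \<kappa> \<rho> \<gamma> = (Th - Tc) / Th *
      (\<gamma> / (\<gamma> + 1 + (\<gamma> + 1)\<^sup>2 / (z * Th) - 1 / 2 * ((Th - Tc) / Th)))"
proof -
  have z: "z = \<alpha>0\<^sup>2 * (Th - Tc) / K Th"
    using K_eq_integral[of Th] Th by (simp add: z_def)
  show z_pos: "z > 0"
    unfolding z using K_Th_pos Th \<alpha>0 by simp
  have K: "K Th = \<alpha>0\<^sup>2 * (Th - Tc) / z"
    using K_Th_pos Th \<alpha>0 by (simp add: z)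
  define D where "D = \<gamma> + 1 + (\<gamma> + 1)\<^sup>2 / (z * Th) - 1 / 2 * ((Th - Tc) / Th)"
  define g where "g = 1 + \<gamma>"
  have g: "g > 0"
    using \<gamma> by (simp add: g_def)
  have c: "c = \<alpha>0 * (Th - Tc) / g"
    by (simp add: c_def voltage_def g_def)
  have D: "D = g + g\<^sup>2 / (z * Th) - (Th - Tc) / (2 * Th)"
    by (simp add: D_def g_def add.commute)
  have K_c: "K Th / c = \<alpha>0 * g / z"
    using \<alpha>0 Th g z_pos by (simp add: K c field_simps power2_eq_square)
  have den: "K Th / c - c / 2 + \<alpha>0 * Th = \<alpha>0 * Th / g * D"
    using g z_pos \<open>Th > 0\<close> unfolding K_c unfolding D c
    by (simp add: field_simps power2_eq_square)
  have "\<gamma> * c / (\<alpha>0 * Th / g * D) = (Th - Tc) / Th * (\<gamma> / D)"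
    using g \<alpha>0 \<open>Th > 0\<close> by (simp add: c)
  then show "efficiency L Ac Th Tc \<alpha>0 \<kappa> \<rho> \<gamma> = (Th - Tc) / Th * (\<gamma> / D)"
    unfolding efficiency_eq den .
qed

end

section \<open>The optimal load ratio\<close>

definition load_denominator :: "real \<Rightarrow> real \<Rightarrow> real \<Rightarrow> real" where
  "load_denominator w \<delta> \<gamma> = \<gamma> + 1 + (\<gamma> + 1)\<^sup>2 / w - 1 / 2 * \<delta>"

lemma load_denominator_pos:
  assumes "w > 0" "\<delta> < 1" "\<gamma> \<ge> 0"
  shows "load_denominator w \<delta> \<gamma> > 0"
proof -
  have "(\<gamma> + 1)\<^sup>2 / w > 0"
    using assms by simp
  then show ?thesis
    using assms(2,3) unfolding load_denominator_def by linarith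
qed

text \<open>The quadratic \<open>D(\<gamma>) - (D(M)/M) \<gamma>\<close> has the root \<open>M\<close>, and the product of its roots is
  \<open>1 + w (1 - \<delta>/2) = M\<^sup>2\<close>.  So \<open>M\<close> is a double root.\<close>

lemma load_denominator_square:
  assumes "w > 0" "M > 0" "M\<^sup>2 = 1 + w * (1 - \<delta> / 2)"
  shows "load_denominator w \<delta> \<gamma> * M - load_denominator w \<delta> M * \<gamma> = M * (\<gamma> - M)\<^sup>2 / w"
proof -
  have \<delta>: "\<delta> = 2 * (1 - (M\<^sup>2 - 1) / w)"
    using assms by (simp add: field_simps)
  show ?thesis
    using assms(1) unfolding load_denominator_def \<delta>
    by (simp add: divide_simps) (simp add: algebra_simps power2_eq_square)
qed

lemma load_ratio_less_optimum:
  assumes "w > 0" "\<delta> < 1" "M > 0" "M\<^sup>2 = 1 + w * (1 - \<delta> / 2)" "\<gamma> \<ge> 0" "\<gamma> \<noteq> M"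
  shows "\<gamma> / load_denominator w \<delta> \<gamma> < M / load_denominator w \<delta> M"
proof -
  have "load_denominator w \<delta> \<gamma> > 0" "load_denominator w \<delta> M > 0"
    using assms by (auto intro: load_denominator_pos)
  moreover have "load_denominator w \<delta> \<gamma> * M - load_denominator w \<delta> M * \<gamma> > 0"
    using assms by (simp add: load_denominator_square)
  ultimately show ?thesis
    by (simp add: divide_simps mult.commute)
qed

text \<open>Using \<open>\<delta> = 2 (1 - (M\<^sup>2 - 1)/w)\<close> to eliminate \<open>\<delta>\<close>, both sides become rational functions of
  \<open>w\<close> and \<open>M\<close>.\<close>

lemma load_ratio_optimal_value:
  assumes "w > 0" "\<delta> < 1" "M > 0" "M\<^sup>2 = 1 + w * (1 - \<delta> / 2)"
  shows "M / load_denominator w \<delta> M = (M - 1) / (M + (1 - \<delta>))"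
proof -
  have \<delta>: "\<delta> = 2 * (1 - (M\<^sup>2 - 1) / w)"
    using assms by (simp add: field_simps)
  have "M * (M + (1 - \<delta>)) = (M - 1) * load_denominator w \<delta> M"
    using assms(1) unfolding load_denominator_def \<delta>
    by (simp add: divide_simps) (simp add: algebra_simps power2_eq_square)
  then show ?thesis
    using assms load_denominator_pos[of w \<delta> M] by (simp add: frac_eq_eq)
qed

theorem theorem2p2:
  fixes L Ac Th Tc \<alpha>0 :: real and \<kappa> \<rho> :: "real \<Rightarrow> real"
  defines "\<Delta>T \<equiv> Th - Tc"
  defines "z \<equiv> \<alpha>0\<^sup>2 / (1 / \<Delta>T * integral {Tc..Th} (\<lambda>t. \<rho> t * \<kappa> t))"
  defines "Tm \<equiv> (Th + Tc) / 2"
  defines "\<eta> \<equiv> efficiency L Ac Th Tc \<alpha>0 \<kappa> \<rho>"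
  assumes "L > 0" and "Ac > 0" and "Th > Tc" and "Tc > 0" and "\<alpha>0 \<noteq> 0"
    and "C1_on {Tc..} \<kappa>" and "\<forall>t\<ge>Tc. \<kappa> t > 0"
    and "local_lipschitz (UNIV :: real set) {Tc..} (\<lambda>_. \<rho>)" and "\<forall>t\<ge>Tc. \<rho> t > 0"
    and "filterlim (\<lambda>b. integral {Tc..b} (\<lambda>t. \<rho> t * \<kappa> t)) at_top at_top"
  shows "(\<forall>\<gamma>\<ge>0. efficiency_well_defined L Ac Th Tc \<alpha>0 \<kappa> \<rho> \<gamma> \<and>
            \<eta> \<gamma> = \<Delta>T / Th *
              (\<gamma> / (\<gamma> + 1 + (\<gamma> + 1)\<^sup>2 / (z * Th) - 1 / 2 * (\<Delta>T / Th)))) \<and>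
         (GREATEST e. e \<in> \<eta> ` {0..}) =
            \<Delta>T / Th * ((sqrt (1 + z * Tm) - 1) / (sqrt (1 + z * Tm) + Tc / Th)) \<and>
         (\<forall>\<gamma>. is_arg_max \<eta> (\<lambda>\<gamma>. \<gamma> \<ge> 0) \<gamma> \<longleftrightarrow> \<gamma> = sqrt (1 + z * Tm))"
proof -
  have leg: "thermoelectric_leg L Ac Th Tc \<alpha>0 \<kappa> \<rho> \<gamma>" if "\<gamma> \<ge> 0" for \<gamma>
  proof
    show "continuous_on {Tc..} \<rho>"
      using local_lipschitz_continuous_on[OF assms(12)] by simp
  qed (use assms(5-) that in auto)
  have "Th > 0"
    using assms by simp
  note closed = thermoelectric_leg.efficiency_closed_form[OF leg \<open>Th > 0\<close>, folded \<Delta>T_def, folded z_def]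
  have "z > 0"
    using closed(1)[of 0] by simp
  define w \<delta> M where "w = z * Th" and "\<delta> = \<Delta>T / Th" and "M = sqrt (1 + z * Tm)"
  have "w > 0"
    using \<open>z > 0\<close> \<open>Th > 0\<close> by (simp add: w_def)
  have "\<delta> > 0" "\<delta> < 1" and Tc: "Tc / Th = 1 - \<delta>"
    using \<open>Th > Tc\<close> \<open>Tc > 0\<close> \<open>Th > 0\<close> by (auto simp: \<delta>_def \<Delta>T_def field_simps)
  have "Tm > 0"
    using \<open>Th > Tc\<close> \<open>Tc > 0\<close> by (simp add: Tm_def)
  then have "M > 0" "M\<^sup>2 = 1 + z * Tm"
    using \<open>z > 0\<close> by (auto simp: M_def add_pos_pos)
  moreover have "z * Tm = w * (1 - \<delta> / 2)"
    using \<open>Th > 0\<close> by (simp add: w_def \<delta>_def \<Delta>T_def Tm_def field_simps)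
  ultimately have M: "M > 0" "M\<^sup>2 = 1 + w * (1 - \<delta> / 2)"
    by auto
  have \<eta>: "\<eta> \<gamma> = \<delta> * (\<gamma> / load_denominator w \<delta> \<gamma>)" if "\<gamma> \<ge> 0" for \<gamma>
    using closed(2)[OF that] by (simp add: \<eta>_def w_def \<delta>_def load_denominator_def)
  have max: "\<eta> \<gamma> < \<eta> M" if "\<gamma> \<ge> 0" "\<gamma> \<noteq> M" for \<gamma>
    unfolding \<eta>[OF that(1)] \<eta>[OF less_imp_le[OF M(1)]]
    using load_ratio_less_optimum[OF \<open>w > 0\<close> \<open>\<delta> < 1\<close> M that] \<open>\<delta> > 0\<close>
    by (rule mult_strict_left_mono)
  have "\<eta> M = \<delta> * ((M - 1) / (M + Tc / Th))"
    using load_ratio_optimal_value[OF \<open>w > 0\<close> \<open>\<delta> < 1\<close> M] M(1) by (simp add: \<eta> Tc)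
  moreover have "(GREATEST e. e \<in> \<eta> ` {0..}) = \<eta> M"
  proof (rule Greatest_equality)
    show "e \<le> \<eta> M" if "e \<in> \<eta> ` {0..}" for e
      using that max by force
  qed (use M(1) in simp)
  moreover have "is_arg_max \<eta> (\<lambda>\<gamma>. \<gamma> \<ge> 0) \<gamma> \<longleftrightarrow> \<gamma> = M" for \<gamma>
    unfolding is_arg_max_def using max M(1) by (metis less_eq_real_def not_less_iff_gr_or_eq)
  ultimately show ?thesis
    using closed(2) thermoelectric_leg.well_defined[OF leg]
    unfolding M_def \<delta>_def \<eta>_def by auto
qed

end
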